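(* Let $\boldsymbol{P}\in\mathbb{P}^{d\times n}$ be a projection matrix and let $\mathcal{S}=\{\boldsymbol{P}^T\boldsymbol{x}:\boldsymbol{x}\in\mathbb{R}^d\}\subset\mathbb{R}^n$ be the corresponding irrational slice. Then $\overline{\mathcal{S}}=\mathcal{M}(\mathcal{S})$ is dense in $\mathbb{T}^n$.
   Context: A matrix $\boldsymbol{P}=(\boldsymbol{p}_1,\dots,\boldsymbol{p}_n)\in\mathbb{R}^{d\times n}$ with columns $\boldsymbol{p}_i\in\mathbb{R}^d$ is a projection matrix, written $\boldsymbol{P}\in\mathbb{P}^{d\times n}$, if $\mathrm{rank}_{\mathbb{R}}(\boldsymbol{P})=d$ and $\mathrm{rank}_{\mathbb{Q}}(\boldsymbol{p}_1,\dots,\boldsymbol{p}_n)=n$, i.e. $\boldsymbol{p}_1,\dots,\boldsymbol{p}_n$ are linearly independent over $\mathbb{Q}$. An irrational slice is a subspace of $\mathbb{R}^n$ of the form $\mathcal{S}=\{\boldsymbol{P}^T\boldsymbol{x}:\boldsymbol{x}\in\mathbb{R}^d\}$ with $\boldsymbol{P}\in\mathbb{P}^{d\times n}$. $\mathbb{T}^n=\mathbb{R}^n/\mathbb{Z}^n$ is the $n$-dimensional torus, identified with $\Omega=[0,1)^n$ by sending each coset to its representative in $[0,1)^n$. The modulo map is $\mathcal{M}:\mathbb{R}^n\to\mathbb{T}^n$, $\boldsymbol{s}\mapsto\overline{\boldsymbol{s}}=\boldsymbol{s}+\mathbb{Z}^n$. A subset $V_1\subset V_2$ is dense in $V_2$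 if for any $\boldsymbol{s}_2\in V_2$ and any $\epsilon>0$ there exists $\boldsymbol{s}_1\in V_1$ with $\|\boldsymbol{s}_1-\boldsymbol{s}_2\|_\infty<\epsilon$, where $\|\boldsymbol{\alpha}\|_\infty=\max_i|\alpha_i|$ (for subsets of $\mathbb{T}^n$, points are viewed as their representatives in $[0,1)^n$). *)

theory Defs
  imports "HOL-Analysis.Analysis"
begin

definition scale_rat :: "rat \<Rightarrow> 'a::real_vector \<Rightarrow> 'a" where
  "scale_rat q v = of_rat q *\<^sub>R v"

global_interpretation rat_vec: vector_space "scale_rat :: rat \<Rightarrow> 'a::real_vector \<Rightarrow> 'a"
  by unfold_locales (simp_all add: scale_rat_def of_rat_add of_rat_mult algebra_simps)

text \<open>The rank over the rationals of the family of columns of \<open>P\<close>: the dimension of the rational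
  subspace that they span. Repeated columns are counted once, so the value \<open>n\<close> forces the
  \<open>n\<close> columns to be distinct and independent (see \<open>rank_rat_full_iff\<close>).\<close>

definition rank_rat :: "real^'n^'d \<Rightarrow> nat" where
  "rank_rat P = rat_vec.dim (columns P)"

text \<open>A matrix with \<open>d\<close> rows and \<open>n\<close> columns has type \<open>real^'n^'d\<close>, so that
  \<open>n = CARD('n)\<close> and \<open>d = CARD('d)\<close>.\<close>

definition projection_matrix :: "real^'n^'d \<Rightarrow> bool" where
  "projection_matrix P \<longleftrightarrow> rank P = CARD('d) \<and> rank_rat P = CARD('n)"

definition slice :: "real^'n^'d \<Rightarrow> (real^'n) set" where
  "slice P = {transpose P *v x | x. True}"

definition int_lattice :: "(real^'n) set" where
  "int_lattice = {z. \<forall>i. z $ i \<in> \<int>}"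

definition mod_map :: "real^'n \<Rightarrow> (real^'n) set" where
  "mod_map s = {s + z | z. z \<in> int_lattice}"

definition torus :: "(real^'n) set set" where
  "torus = range mod_map"

definition unit_box :: "(real^'n) set" where
  "unit_box = {s. \<forall>i. 0 \<le> s $ i \<and> s $ i < 1}"

definition torus_rep :: "(real^'n) set \<Rightarrow> real^'n" where
  "torus_rep c = (THE s. s \<in> c \<and> s \<in> unit_box)"

text \<open>\<^const>\<open>infnorm\<close> is the maximum norm of the coordinates on \<open>real^'n\<close>.\<close>

definition dense_in :: "(real^'n) set \<Rightarrow> (real^'n) set \<Rightarrow> bool" where
  "dense_in V1 V2 \<longleftrightarrow> V1 \<subseteq> V2 \<and> (\<forall>s2\<in>V2. \<forall>\<epsilon>>0. \<exists>s1\<in>V1. infnorm (s1 - s2) < \<epsilon>)"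

text \<open>Density for sets of cosets is density of the sets of their representatives in
  \<open>[0,1)\<^sup>n\<close>; in particular the distance does not wrap around.\<close>

definition dense_in_torus :: "(real^'n) set set \<Rightarrow> bool" where
  "dense_in_torus A \<longleftrightarrow> A \<subseteq> torus \<and> dense_in (torus_rep ` A) (torus_rep ` torus)"

lemma rank_rat_full_iff:
  fixes P :: "real^'n^'d"
  shows "rank_rat P = CARD('n) \<longleftrightarrow>
    inj (\<lambda>j. column j P) \<and> rat_vec.independent (columns P)"
proof -
  have col: "columns P = range (\<lambda>j. column j P)"
    by (auto simp: columns_def)
  have fin: "finite (columns P)"
    unfolding col by simp
  show ?thesis
  proof
    assume r: "rank_rat P = CARD('n)"
    have "rat_vec.dim (columns P) \<le> card (columns P)"
      by (rule rat_vec.dim_le_card'[OF fin])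
    moreover have "card (columns P) \<le> CARD('n)"
      unfolding col by (rule card_image_le) simp
    ultimately have c: "card (columns P) = CARD('n)" "rat_vec.dim (columns P) = card (columns P)"
      using r by (simp_all add: rank_rat_def)
    have "inj (\<lambda>j. column j P)"
      using c(1) unfolding col by (intro eq_card_imp_inj_on) auto
    moreover obtain B where B: "B \<subseteq> columns P" "rat_vec.independent B"
      "card B = rat_vec.dim (columns P)"
      by (rule rat_vec.basis_exists)
    have "B = columns P"
      using card_subset_eq[OF fin B(1)] B(3) c(2) by simp
    with B(2) have "rat_vec.independent (columns P)"
      by simp
    ultimately show "inj (\<lambda>j. column j P) \<and> rat_vec.independent (columns P)" ..
  next
    assume a: "inj (\<lambda>j. column j P) \<and> rat_vec.independent (columns P)"
    then have "rat_vec.dim (columns P) = card (columns P)"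
      by (auto intro: rat_vec.dim_eq_card_independent)
    also have "\<dots> = CARD('n)"
      using a unfolding col by (auto intro: card_image)
    finally show "rank_rat P = CARD('n)"
      by (simp add: rank_rat_def)
  qed
qed

lemma torus_rep_mod_map: "torus_rep (mod_map s) = (\<chi> i. frac (s $ i))"
  unfolding torus_rep_def
proof (rule the_equality)
  have "(\<chi> i. frac (s $ i)) = s + (\<chi> i. - of_int \<lfloor>s $ i\<rfloor>)"
    by (simp add: vec_eq_iff frac_def)
  moreover have "(\<chi> i. - of_int \<lfloor>s $ i\<rfloor>) \<in> int_lattice"
    by (simp add: int_lattice_def)
  ultimately have "(\<chi> i. frac (s $ i)) \<in> mod_map s"
    unfolding mod_map_def by blast
  then show "(\<chi> i. frac (s $ i)) \<in> mod_map s \<and> (\<chi> i. frac (s $ i)) \<in> unit_box"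
    by (simp add: unit_box_def frac_lt_1)
next
  fix t assume t: "t \<in> mod_map s \<and> t \<in> unit_box"
  then obtain z where z: "t = s + z" "z \<in> int_lattice"
    by (auto simp: mod_map_def)
  show "t = (\<chi> i. frac (s $ i))"
  proof (simp add: vec_eq_iff, rule allI)
    fix i
    have "s $ i - t $ i \<in> \<int>" "0 \<le> t $ i" "t $ i < 1"
      using z t by (auto simp: int_lattice_def unit_box_def)
    then show "t $ i = frac (s $ i)"
      using frac_unique_iff[of "s $ i" "t $ i"] by auto
  qed
qed

end

theory Submission
  imports Defs
begin

text \<open>A generic vector \<open>x\<close> of \<open>\<real>\<^sup>d\<close> avoids the countably many hyperplanes orthogonal to the nonzero
  integer combinations of the columns of \<open>P\<close>, so the coordinates of \<open>\<theta> = P\<^sup>T x\<close> are linearly independent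
  over the integers. By Kronecker's theorem the single line \<open>{t \<theta> | t}\<close>, which lies in the slice, is
  already dense modulo \<open>\<int>\<^sup>n\<close>.\<close>

text \<open>\<open>Kronecker_thm_1\<close> speaks of sequences indexed by an initial segment of the
  naturals and of independence of a set of reals. Enumerating \<open>'n\<close> by \<open>e\<close>
  carries it over to vectors; independence of the coordinates as a family supplies both its
  injectivity and its independence hypothesis.\<close>

lemma Kronecker_vec:
  fixes \<theta> \<alpha> :: "real^'n"
  assumes indep: "\<And>c :: 'n \<Rightarrow> int. (\<Sum>i\<in>UNIV. of_int (c i) * \<theta> $ i) = 0 \<Longrightarrow> c = (\<lambda>_. 0)"
    and "\<epsilon> > 0"
  obtains t :: real and h :: "'n \<Rightarrow> int" where "\<And>i. \<bar>t * \<theta> $ i - of_int (h i) - \<alpha> $ i\<bar> < \<epsilon>"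
proof -
  interpret int_real: module "\<lambda>r. (*) (real_of_int r)"
    by unfold_locales (simp_all add: algebra_simps)
  obtain e where e: "bij_betw e {..<CARD('n)} (UNIV :: 'n set)"
    using ex_bij_betw_nat_finite[of "UNIV :: 'n set"] by (auto simp: atLeast0LessThan)
  have inj: "inj (($) \<theta>)"
  proof (rule injI, rule ccontr)
    fix i j assume ij: "\<theta> $ i = \<theta> $ j" "i \<noteq> j"
    \<comment> \<open>Equal coordinates \<open>i\<close> and \<open>j\<close> would give the
      nontrivial integer relation with coefficients 1 at \<open>i\<close> and -1 at
      \<open>j\<close>.\<close>
    let ?c = "\<lambda>k. (if k = i then 1 else 0) - (if k = j then 1 else 0) :: int"
    have "(\<Sum>k\<in>UNIV. of_int (?c k) * \<theta> $ k) =
        (\<Sum>k\<in>UNIV. (if k = i then \<theta> $ k else 0) - (if k = j then \<theta> $ k else 0))"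
      by (rule sum.cong) auto
    also have "\<dots> = 0"
      using ij by (simp add: sum_subtractf)
    finally have "?c = (\<lambda>_. 0)"
      by (rule indep)
    from fun_cong[OF this, of i] ij show False
      by simp
  qed
  have image: "(\<lambda>k. \<theta> $ e k) ` {..<CARD('n)} = range (($) \<theta>)"
    using e by (metis bij_betw_imp_surj_on image_image)
  have "int_real.independent (range (($) \<theta>))"
  proof
    assume "int_real.dependent (range (($) \<theta>))"
    then obtain u i where u: "u (\<theta> $ i) \<noteq> 0" "(\<Sum>v\<in>range (($) \<theta>). real_of_int (u v) * v) = 0"
      by (auto simp: int_real.dependent_finite)
    then have "(\<Sum>i\<in>UNIV. of_int (u (\<theta> $ i)) * \<theta> $ i) = 0"
      by (simp add: sum.reindex[OF inj])
    from fun_cong[OF indep[OF this], of i] u(1) show False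
      by simp
  qed
  moreover have "inj_on (\<lambda>k. \<theta> $ e k) {..<CARD('n)}"
    using e inj by (auto simp: inj_on_def bij_betw_def)
  ultimately obtain t h where th:
    "\<And>k. k < CARD('n) \<Longrightarrow> \<bar>t * \<theta> $ e k - of_int (h k) - \<alpha> $ e k\<bar> < \<epsilon>"
    using Kronecker_thm_1[of "\<lambda>k. \<theta> $ e k" "CARD('n)" \<epsilon> "\<lambda>k. \<alpha> $ e k"] \<open>\<epsilon> > 0\<close>
    unfolding image by blast
  let ?e' = "inv_into {..<CARD('n)} e"
  have "?e' i < CARD('n)" "e (?e' i) = i" for i
    using e by (metis UNIV_I bij_betw_imp_surj_on inv_into_into lessThan_iff,
      metis UNIV_I bij_betw_inv_into_right)
  then have "\<bar>t * \<theta> $ i - of_int (h (?e' i)) - \<alpha> $ i\<bar> < \<epsilon>" for i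
    using th[of "?e' i"] by simp
  then show thesis
    by (rule that)
qed

text \<open>Each hyperplane orthogonal to a nonzero vector is a null set, and countably many null
  sets cannot cover the space.\<close>

lemma exists_inner_nonzero:
  fixes A :: "'a::euclidean_space set"
  assumes "countable A" "0 \<notin> A"
  obtains x where "\<And>a. a \<in> A \<Longrightarrow> a \<bullet> x \<noteq> 0"
proof -
  have "negligible (\<Union>a\<in>A. {x. a \<bullet> x = 0})"
    using assms by (intro negligible_countable_Union) (auto intro!: negligible_hyperplane)
  then have "(\<Union>a\<in>A. {x. a \<bullet> x = 0}) \<noteq> UNIV"
    by (metis non_negligible_UNIV)
  then show thesis
    using that by auto
qed

lemma columns_int_independent:
  fixes P :: "real^'n^'d" and c :: "'n \<Rightarrow> int"
  assumes "projection_matrix P" and zero: "(\<Sum>i\<in>UNIV. of_int (c i) *\<^sub>R column i P) = 0"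
  shows "c = (\<lambda>_. 0)"
proof
  fix i
  have inj: "inj (\<lambda>j. column j P)" and indep: "rat_vec.independent (range (\<lambda>j. column j P))"
    using assms(1) rank_rat_full_iff[of P]
    by (auto simp: projection_matrix_def columns_def full_SetCompr_eq)
  \<comment> \<open>Independence of a set needs coefficients attached to the columns themselves;
    since the columns are distinct, they can be read off from the indices.\<close>
  let ?u = "\<lambda>v. rat_of_int (c (inv (\<lambda>j. column j P) v))"
  have "(\<Sum>v\<in>range (\<lambda>j. column j P). scale_rat (?u v) v) = 0"
    using zero by (simp add: sum.reindex[OF inj] inv_f_f[OF inj] scale_rat_def)
  then have "?u (column i P) = 0"
    using rat_vec.independentD[OF indep, where t = "range (\<lambda>j. column j P)" and u = ?u] by auto
  then show "c i = 0"
    by (simp add: inv_f_f[OF inj])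
qed

text \<open>An integer combination of the coordinates of \<open>transpose P *v x\<close> is the
  inner product of \<open>x\<close> with the same combination of columns. For nonzero coefficients
  the latter is a nonzero vector, and there are only countably many integer families over the finite
  type \<open>'n\<close>.\<close>

lemma projection_matrix_generic_vector:
  fixes P :: "real^'n^'d"
  assumes "projection_matrix P"
  obtains x where "\<And>c :: 'n \<Rightarrow> int.
    (\<Sum>i\<in>UNIV. of_int (c i) * (transpose P *v x) $ i) = 0 \<Longrightarrow> c = (\<lambda>_. 0)"
proof -
  define comb where "comb c = (\<Sum>i\<in>UNIV. of_int (c i) *\<^sub>R column i P)" for c :: "'n \<Rightarrow> int"
  have "0 \<notin> comb ` (- {\<lambda>_. 0})"
    using columns_int_independent[OF assms] by (auto simp: comb_def)
  then obtain x where x: "\<And>a. a \<in> comb ` (- {\<lambda>_. 0}) \<Longrightarrow> a \<bullet> x \<noteq> 0"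
    using exists_inner_nonzero[of "comb ` (- {\<lambda>_. 0})"] by (metis countableI_type countable_image)
  have "(\<Sum>i\<in>UNIV. of_int (c i) * (transpose P *v x) $ i) = comb c \<bullet> x" for c
    by (simp add: comb_def inner_sum_left matrix_vector_mul_component transpose_def column_def
        row_def)
  with x show thesis
    by (intro that[of x]) auto
qed

lemma infnorm_less_iff:
  fixes x :: "real^'n"
  shows "infnorm x < e \<longleftrightarrow> (\<forall>i. \<bar>x $ i\<bar> < e)"
  by (auto simp: infnorm_Max Basis_vec_def inner_axis)

theorem theorem3p1:
  fixes P :: "real^'n^'d"
  assumes "projection_matrix P"
  shows "dense_in_torus (mod_map ` slice P)"
proof -
  obtain x where x: "\<And>c :: 'n \<Rightarrow> int.
      (\<Sum>i\<in>UNIV. of_int (c i) * (transpose P *v x) $ i) = 0 \<Longrightarrow> c = (\<lambda>_. 0)"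
    using projection_matrix_generic_vector[OF assms] by blast
  have "\<exists>s\<in>slice P. infnorm (torus_rep (mod_map s) - torus_rep (mod_map r)) < \<epsilon>"
    if "\<epsilon> > 0" for r \<epsilon>
  proof -
    let ?a = "\<lambda>i. frac (r $ i)"
    \<comment> \<open>Aiming at the centre of the cube \<open>\<Prod>\<^sub>i (a\<^sub>i, a\<^sub>i + 2 \<delta>) \<subseteq> (0,1)\<^sup>n\<close> instead of at \<open>a\<close> itself avoids
      wrapping around.\<close>
    define \<delta> where "\<delta> = Min (insert \<epsilon> (range (\<lambda>i. 1 - ?a i))) / 2"
    have "\<delta> > 0"
      using that by (auto simp: \<delta>_def frac_lt_1)
    have "2 * \<delta> \<le> \<epsilon>" and le: "?a i + 2 * \<delta> \<le> 1" for i
    proof -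
      show "2 * \<delta> \<le> \<epsilon>"
        by (simp add: \<delta>_def)
      have "2 * \<delta> \<le> 1 - ?a i"
        unfolding \<delta>_def by (simp add: min.coboundedI2)
      then show "?a i + 2 * \<delta> \<le> 1"
        by simp
    qed
    obtain t h where th:
      "\<And>i. \<bar>t * (transpose P *v x) $ i - of_int (h i) - (\<chi> i. ?a i + \<delta>) $ i\<bar> < \<delta>"
      using Kronecker_vec[OF x \<open>\<delta> > 0\<close>, where \<alpha> = "\<chi> i. ?a i + \<delta>"] by blast
    let ?s = "transpose P *v (t *\<^sub>R x)"
    have "\<bar>frac (?s $ i) - ?a i\<bar> < \<epsilon>" for i
    proof -
      have s: "?s $ i = t * (transpose P *v x) $ i"
        by (simp add: matrix_vector_mult_scaleR)
      have b: "?a i < ?s $ i - of_int (h i)" "?s $ i - of_int (h i) < ?a i + 2 * \<delta>"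
        using th[of i] unfolding s abs_less_iff vec_lambda_beta by linarith+
      \<comment> \<open>The shifted coordinate lies strictly between \<open>?a i\<close>, which is
        at least 0, and \<open>?a i + 2 * \<delta>\<close>, which is at most 1, so it is the
        representative in [0,1).\<close>
      then have "frac (?s $ i) = ?s $ i - of_int (h i)"
        using le[of i] frac_ge_0[of "r $ i"] unfolding frac_unique_iff
        by (intro conjI) (simp, linarith+)
      then show ?thesis
        using b \<open>2 * \<delta> \<le> \<epsilon>\<close> by simp
    qed
    moreover have "?s \<in> slice P"
      by (auto simp: slice_def)
    ultimately show ?thesis
      by (auto simp: torus_rep_mod_map infnorm_less_iff)
  qed
  then show ?thesis
    by (auto simp: dense_in_torus_def dense_in_def torus_def)
qed

end
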